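(* Let $A\subset\mathbb{R}$ be an arbitrary infinite set. (a) For any real $a\neq0$ and real $r$ with $0<|r|<1$, the sets $\{ar^n:n\ge1\}+A$ and $\{ar^n:n\ge1\}-A$ are not measure universal. (b) If $(a_n)_{n\ge1}$ is a decreasing sequence of positive real numbers with $a_n\to0$ and $\liminf_{n\to\infty}a_{n+1}/a_n>0$ (which in particular implies $a_n\ge e^{-Cn}$ for some $C>0$ and all large $n$), then $\{a_n\}+A$ and $\{a_n\}-A$ are not measure universal. In particular, $\{a_n\}+\{a_n\}$ and $\{a_n\}-\{a_n\}$ are not measure universal.
   Context: A set $E\subset\mathbb{R}$ is measure universal if for every Lebesgue measurable $L\subset\mathbb{R}$ of positive Lebesgue measure there exist $x\in\mathbb{R}$ and $\lambda\neq0$ with $x+\lambda E\subset L$. For sets $X,Y\subset\mathbb{R}$, $X\pm Y=\{x\pm y: x\in X,\ y\in Y\}$; $\{a_n\}$ denotes the set $\{a_n:n\ge1\}$. *)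

theory Defs
  imports "HOL-Analysis.Analysis" "HOL-Library.Set_Algebras"
begin

definition measure_universal :: "real set \<Rightarrow> bool" where
  "measure_universal E \<longleftrightarrow>
     (\<forall>L. L \<in> sets lebesgue \<and> emeasure lebesgue L > 0 \<longrightarrow>
        (\<exists>x t. t \<noteq> 0 \<and> (\<lambda>e. x + t * e) ` E \<subseteq> L))"

(* On sets, "X + Y" is the Minkowski sum of Set_Algebras, but "X - Y" is the
   set-theoretic difference; the set of pairwise differences needs its own name. *)
definition difference_set :: "real set \<Rightarrow> real set \<Rightarrow> real set" where
  "difference_set X Y = {x - y | x y. x \<in> X \<and> y \<in> Y}"

end

theory Submission
  imports Defs
begin

text \<open>If \<open>E\<close> contains, for every \<open>\<sigma> > 0\<close>, large finite \<open>\<delta>\<close>-separated subsets \<open>F\<close> with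
  \<open>ln (1 / \<delta>) \<le> \<sigma> |F|\<close>, then \<open>E\<close> is not measure universal (Kolountzakis). At mesh
  \<open>1 / K\<close>, with \<open>K\<close> comparable to \<open>1 / \<delta>\<close>, the copies of \<open>F\<close> in the unit interval at bounded
  scales follow only \<open>O(K\<^sup>2)\<close> patterns of \<open>|F|\<close> distinct cells; greedily, a small proportion of
  the cells meets all of them, because \<open>O(K\<^sup>2)\<close> is much less than \<open>exp (\<epsilon> |F|)\<close>. Removing such
  cells for a sequence of scale ranges exhausting all \<open>t \<noteq> 0\<close> leaves a set of positive measure.

  A sum \<open>{a\<^sub>n} + Y\<close> has this property: fix \<open>M\<close> points of \<open>Y\<close>, and add to them \<open>N\<close> terms \<open>a\<^sub>n\<close>
  that are small compared with the gaps between these points. The \<open>M N\<close> sums are separated by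
  about \<open>exp (- C N)\<close>, where \<open>C\<close> does not depend on \<open>M\<close>, and \<open>C / M\<close> is as small as desired.\<close>

section \<open>Greedy hitting sets for families of large finite sets\<close>

text \<open>Double counting of incidences: every set not yet hit has at least \<open>n\<close>
  points in \<open>U\<close>, so some point of \<open>U\<close> lies in at least the proportion
  \<open>n / card U\<close> of these sets. Each greedy choice thus multiplies the number of
  survivors by at most \<open>1 - n / card U\<close>.\<close>

lemma greedy_hitting_set:
  fixes U :: "'a set" and \<F> :: "'a set set"
  assumes "finite U" "finite \<F>" "n \<le> card U"
    and sub: "\<And>W. W \<in> \<F> \<Longrightarrow> W \<subseteq> U" and crd: "\<And>W. W \<in> \<F> \<Longrightarrow> n \<le> card W"
  shows "\<exists>S\<subseteq>U. card S \<le> s \<and>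
    real (card {W \<in> \<F>. W \<inter> S = {}}) \<le> real (card \<F>) * (1 - real n / real (card U)) ^ s"
proof (induction s)
  case 0
  show ?case by (intro exI[of _ "{}"]) auto
next
  case (Suc s)
  define q where "q = real n / real (card U)"
  have q: "q \<le> 1" using assms(3) by (cases "card U = 0") (auto simp: q_def)
  from Suc obtain S where S: "S \<subseteq> U" "card S \<le> s"
    "real (card {W \<in> \<F>. W \<inter> S = {}}) \<le> real (card \<F>) * (1 - q) ^ s"
    unfolding q_def by blast
  define \<G> where "\<G> = {W \<in> \<F>. W \<inter> S = {}}"
  have fG: "finite \<G>" using assms(2) by (simp add: \<G>_def)
  have bound: "real (card \<G>) * (1 - q) \<le> real (card \<F>) * (1 - q) ^ Suc s"
    using mult_right_mono[OF S(3), of "1 - q"] q by (simp add: \<G>_def mult_ac)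
  show ?case
  proof (cases "U = {}")
    \<comment> \<open>Division by zero gives \<open>q = 0\<close>, so the required bound does not
      shrink and \<open>S\<close> can be kept.\<close>
    case True
    then have "q = 0" by (simp add: q_def)
    then show ?thesis
      using S bound unfolding \<G>_def[symmetric] q_def[symmetric]
      by (intro exI[of _ S]) (auto simp: \<G>_def)
  next
    case False
    then have U0: "card U > 0" using assms(1) by (simp add: card_gt_0_iff)
    obtain u where u: "u \<in> U" "q * real (card \<G>) \<le> real (card {W \<in> \<G>. u \<in> W})"
    proof (rule ccontr)
      assume "\<not> thesis"
      with that have less: "\<And>u. u \<in> U \<Longrightarrow> real (card {W \<in> \<G>. u \<in> W}) < q * real (card \<G>)"
        by fastforce
      have "(\<Sum>u\<in>U. real (card {W \<in> \<G>. u \<in> W})) < (\<Sum>u\<in>U. q * real (card \<G>))"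
        using less assms(1) False by (intro sum_strict_mono) auto
      also have "\<dots> = real n * real (card \<G>)"
        using U0 by (simp add: q_def)
      also have "\<dots> \<le> (\<Sum>W\<in>\<G>. real (card W))"
        using sum_bounded_below[of \<G> "real n" "\<lambda>W. real (card W)"] crd
        by (simp add: \<G>_def mult.commute)
      also have "\<dots> = (\<Sum>W\<in>\<G>. \<Sum>u\<in>U. if u \<in> W then 1 else 0)"
      proof (intro sum.cong refl)
        fix W assume "W \<in> \<G>"
        then have "U \<inter> W = W" using sub by (auto simp: \<G>_def)
        then show "real (card W) = (\<Sum>u\<in>U. if u \<in> W then 1 else 0)"
          using assms(1) by (simp add: sum.If_cases Int_def[symmetric])
      qed
      also have "\<dots> = (\<Sum>u\<in>U. \<Sum>W\<in>\<G>. if u \<in> W then 1 else 0)"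
        by (rule sum.swap)
      also have "\<dots> = (\<Sum>u\<in>U. real (card {W \<in> \<G>. u \<in> W}))"
        using fG by (simp add: sum.If_cases Int_def)
      finally show False by simp
    qed
    have "card {W \<in> \<F>. W \<inter> insert u S = {}} = card (\<G> - {W \<in> \<G>. u \<in> W})"
      by (rule arg_cong[of _ _ card]) (auto simp: \<G>_def)
    also have "real \<dots> = real (card \<G>) - real (card {W \<in> \<G>. u \<in> W})"
      using fG by (subst card_Diff_subset) (auto intro!: of_nat_diff card_mono)
    also have "\<dots> \<le> real (card \<G>) * (1 - q)"
      using u(2) by (simp add: algebra_simps)
    finally have "real (card {W \<in> \<F>. W \<inter> insert u S = {}}) \<le> real (card \<F>) * (1 - q) ^ Suc s"
      using bound by linarith
    moreover have "card (insert u S) \<le> Suc s"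
      using S(2) card_insert_le_m1[of "Suc s" S u] by simp
    ultimately show ?thesis
      using u(1) S(1) unfolding q_def by (intro exI[of _ "insert u S"]) auto
  qed
qed

text \<open>Since \<open>1 - q \<le> exp (- q)\<close>, fewer than one set survives \<open>s\<close>
  greedy choices, hence none does.\<close>

lemma hitting_set:
  fixes U :: "'a set" and \<F> :: "'a set set"
  assumes "finite U" "finite \<F>"
    and sub: "\<And>W. W \<in> \<F> \<Longrightarrow> W \<subseteq> U" and crd: "\<And>W. W \<in> \<F> \<Longrightarrow> n \<le> card W"
    and small: "real (card \<F>) < exp (real n * real s / real (card U))"
  obtains S where "S \<subseteq> U" "card S \<le> s" "\<And>W. W \<in> \<F> \<Longrightarrow> W \<inter> S \<noteq> {}"
proof (cases "\<F> = {}")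
  case True
  then show ?thesis using that[of "{}"] by simp
next
  case False
  then obtain W where "W \<in> \<F>" by blast
  with sub crd assms(1) have nU: "n \<le> card U"
    by (meson card_mono order_trans)
  define q where "q = real n / real (card U)"
  have q: "q \<le> 1" using nU by (cases "card U = 0") (auto simp: q_def)
  obtain S where S: "S \<subseteq> U" "card S \<le> s"
    "real (card {W \<in> \<F>. W \<inter> S = {}}) \<le> real (card \<F>) * (1 - q) ^ s"
    using greedy_hitting_set[OF assms(1,2) nU sub crd] unfolding q_def by blast
  have "(1 - q) ^ s \<le> exp (- q) ^ s"
    using q exp_ge_add_one_self[of "- q"] by (intro power_mono) auto
  also have "\<dots> = exp (- (real n * real s / real (card U)))"
    by (simp add: q_def exp_of_nat_mult[symmetric] mult_ac)
  finally have "real (card \<F>) * (1 - q) ^ s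
      \<le> real (card \<F>) * exp (- (real n * real s / real (card U)))"
    by (intro mult_left_mono) auto
  also have "\<dots> < exp (real n * real s / real (card U)) * exp (- (real n * real s / real (card U)))"
    using small by (intro mult_strict_right_mono) auto
  also have "\<dots> = 1" by (simp add: exp_minus)
  finally have "card {W \<in> \<F>. W \<inter> S = {}} = 0" using S(3) by linarith
  then have "{W \<in> \<F>. W \<inter> S = {}} = {}" using assms(2) by simp
  with S(1,2) show ?thesis using that[of S] by blast
qed

section \<open>Separated finite subsets and sets containing no affine copy\<close>

definition separated :: "real \<Rightarrow> real set \<Rightarrow> bool" where
  "separated \<delta> F \<longleftrightarrow> (\<forall>x\<in>F. \<forall>y\<in>F. x \<noteq> y \<longrightarrow> \<delta> \<le> \<bar>x - y\<bar>)"

lemma separatedD: "separated \<delta> F \<Longrightarrow> x \<in> F \<Longrightarrow> y \<in> F \<Longrightarrow> x \<noteq> y \<Longrightarrow> \<delta> \<le> \<bar>x - y\<bar>"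
  by (simp add: separated_def)

text \<open>The arbitrary \<open>D\<close> absorbs constants in the count of patterns; these depend
  on the bound for \<open>E\<close>, the range of scales and the allowed measure, but not on
  \<open>\<delta>\<close>.\<close>

definition separation_rich :: "real set \<Rightarrow> bool" where
  "separation_rich E \<longleftrightarrow> (\<forall>\<sigma>>0. \<forall>D. \<exists>F \<delta>. finite F \<and> F \<subseteq> E \<and> 0 < \<delta> \<and> \<delta> \<le> 1 \<and>
     separated \<delta> F \<and> D - ln \<delta> \<le> \<sigma> * real (card F))"

text \<open>Putting the points of a copy of \<open>F\<close> in distinct cells needs
  \<open>K\<close> of order \<open>1 / \<delta>\<close> only. Richness then makes
  \<open>ln K\<close> small against \<open>\<epsilon> * card F\<close>, which is the condition of
  \<open>hitting_set\<close> for about \<open>K^2\<close> patterns.\<close>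

lemma small_set_meeting_copies:
  assumes rich: "separation_rich E" and B: "B \<ge> 1" "\<And>e. e \<in> E \<Longrightarrow> \<bar>e\<bar> \<le> B"
    and R: "R \<ge> 1" and \<epsilon>: "0 < \<epsilon>" "\<epsilon> \<le> (1::real)"
  shows "\<exists>G \<in> sets borel. emeasure lborel G \<le> ennreal \<epsilon> \<and>
    (\<forall>x t. 1 / R \<le> \<bar>t\<bar> \<and> \<bar>t\<bar> \<le> R \<and> (\<lambda>e. x + t * e) ` E \<subseteq> {0..1} \<longrightarrow>
      (\<lambda>e. x + t * e) ` E \<inter> G \<noteq> {})"
proof -
  define C where "C = (2 * (1 + R * B) + 3) * (2 * (R * B) + 3)"
  have RB: "R * B \<ge> 1" using B(1) R by (metis mult_mono' mult_1 zero_le_one)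
  have C: "C > 0" using RB by (auto simp: C_def intro!: mult_pos_pos)
  \<comment> \<open>Below, \<open>s / card U\<close> is at least \<open>\<epsilon> / 24\<close>, and
    \<open>K\<close> occurs squared in the count of patterns; halving gives
    \<open>\<epsilon> / 48\<close>. The summand 1 in the next choice of \<open>D\<close> makes the
    final inequality strict.\<close>
  have "\<epsilon> / 48 > 0" using \<epsilon> by simp
  then obtain F \<delta> where F: "finite F" "F \<subseteq> E" and \<delta>: "0 < \<delta>" "\<delta> \<le> 1" "separated \<delta> F"
    and big: "(ln C / 2 + ln (13 * R / \<epsilon>) + 1) - ln \<delta> \<le> \<epsilon> / 48 * real (card F)"
    using rich unfolding separation_rich_def by meson
  define n where "n = card F"
  \<comment> \<open>With this \<open>K\<close>, points of a copy of \<open>F\<close> at scale at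
    least \<open>1 / R\<close> are at least 12 mesh widths apart, twice the total rounding error 6
    of two points. Also \<open>K * \<epsilon> \<ge> 12\<close>, so rounding down in \<open>s\<close>
    loses at most half.\<close>
  define K where "K = nat \<lceil>12 * R / (\<epsilon> * \<delta>)\<rceil>"
  have ed: "0 < \<epsilon> * \<delta>" "\<epsilon> * \<delta> \<le> \<delta>" "\<epsilon> * \<delta> \<le> \<epsilon>" "\<epsilon> * \<delta> \<le> 1"
    using \<epsilon> \<delta> by (auto simp: mult_le_one mult_left_le mult_left_le_one_le)
  have K0: "real K \<ge> 12 * R / (\<epsilon> * \<delta>)" unfolding K_def by linarith
  have "12 * R / (\<epsilon> * \<delta>) \<ge> 0" using R ed by auto
  then have "real K \<le> 12 * R / (\<epsilon> * \<delta>) + 1" unfolding K_def by linarith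
  moreover define T where "T = R / (\<epsilon> * \<delta>)"
  moreover have "1 \<le> T" using R ed by (simp add: T_def le_divide_eq)
  moreover have "12 * R / (\<epsilon> * \<delta>) = 12 * T" "13 * R / (\<epsilon> * \<delta>) = 13 * T" by (simp_all add: T_def)
  ultimately have K1: "real K \<le> 13 * R / (\<epsilon> * \<delta>)" by argo
  have Ked: "real K * (\<epsilon> * \<delta>) \<ge> 12 * R" using K0 ed by (simp add: pos_divide_le_eq)
  have Kd: "real K * \<delta> \<ge> 12 * R"
    using Ked mult_left_mono[OF ed(2), of "real K"] by linarith
  have Ke: "real K * \<epsilon> \<ge> 12"
    using Ked mult_left_mono[OF ed(3), of "real K"] R by linarith
  have K12: "real K \<ge> 12"
    using Ke mult_left_mono[OF \<epsilon>(2), of "real K"] by simp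
  \<comment> \<open>Each chosen cell will be thickened to an interval of length
    \<open>6 / K\<close>, so \<open>s\<close> of them have measure at most
    \<open>\<epsilon>\<close>.\<close>
  define s where "s = nat \<lfloor>\<epsilon> * real K / 6\<rfloor>"
  have s1: "real s \<le> \<epsilon> * real K / 6" proof -
    have "0 \<le> \<epsilon> * real K / 6" using \<epsilon> by simp
    then show ?thesis unfolding s_def by linarith
  qed
  have s2: "real s \<ge> \<epsilon> * real K / 12"
  proof -
    have "real s \<ge> \<epsilon> * real K / 6 - 1" unfolding s_def by linarith
    then show ?thesis using Ke by (simp add: mult.commute)
  qed
  \<comment> \<open>The margin 3 allows for the rounding error of \<open>w\<close> around the range
    from 0 to \<open>K\<close>.\<close>
  define U where "U = {- 3..int K + 3}"
  have fU: "finite U" and cU: "real (card U) = real K + 7" by (simp_all add: U_def)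
  \<comment> \<open>Here \<open>p\<close> stands for \<open>K * x\<close> and \<open>q\<close> for
    \<open>K * B * t\<close>, both rounded down. Scaling by \<open>B\<close> keeps the error from
    \<open>q\<close> at most 1, because \<open>\<bar>f / B\<bar> \<le> 1\<close>.\<close>
  define w where "w p q f = \<lfloor>real_of_int p + real_of_int q * f / B\<rfloor>" for p q :: int and f
  define bp where "bp = \<lfloor>real K * (1 + R * B)\<rfloor> + 1"
  define bq where "bq = \<lfloor>real K * (R * B)\<rfloor> + 1"
  \<comment> \<open>Only patterns with the properties that \<open>hitting_set\<close> asks for are
    kept; that actual copies of \<open>F\<close> yield such patterns is checked for each
    \<open>x\<close> and \<open>t\<close> below.\<close>
  define \<F> where "\<F> = {W \<in> (\<lambda>(p, q). w p q ` F) ` ({- bp..bp} \<times> {- bq..bq}). W \<subseteq> U \<and> n \<le> card W}"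
  have fF: "finite \<F>" by (simp add: \<F>_def)
  have pos: "0 \<le> real K * (1 + R * B)" "0 \<le> real K * (R * B)" using RB by auto
  have bpq: "0 \<le> bp" "0 \<le> bq" using pos unfolding bp_def bq_def by linarith+
  have "card \<F> \<le> card ({- bp..bp} \<times> {- bq..bq})"
    unfolding \<F>_def
    by (rule order_trans[OF card_mono card_image_le]) auto
  also have "real \<dots> = (2 * real_of_int bp + 1) * (2 * real_of_int bq + 1)"
    using pos by (simp add: card_cartesian_product bp_def bq_def)
  also have "\<dots> \<le> ((2 * (1 + R * B) + 3) * real K) * ((2 * (R * B) + 3) * real K)"
  proof (intro mult_mono)
    have "real_of_int bp \<le> real K * (1 + R * B) + 1" "real_of_int bq \<le> real K * (R * B) + 1"
      unfolding bp_def bq_def by linarith+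
    then show "2 * real_of_int bp + 1 \<le> (2 * (1 + R * B) + 3) * real K"
      "2 * real_of_int bq + 1 \<le> (2 * (R * B) + 3) * real K"
      using K12 by (simp_all add: algebra_simps)
  qed (use pos RB in \<open>auto simp: bp_def bq_def\<close>)
  also have "\<dots> = C * real K ^ 2" by (simp add: C_def power2_eq_square mult_ac)
  also have "\<dots> = exp (ln C + 2 * ln (real K))"
    using C K12 by (simp add: exp_add exp_double)
  also have "\<dots> < exp (real n * real s / real (card U))"
  proof -
    have "ln (real K) \<le> ln (13 * R / \<epsilon> / \<delta>)"
      using K1 K12 by (intro ln_mono) auto
    also have "\<dots> = ln (13 * R / \<epsilon>) - ln \<delta>"
      using R \<epsilon> \<delta> by (intro ln_divide_pos) auto
    finally have "ln C + 2 * ln (real K) < \<epsilon> / 24 * real n"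
      using big by (simp add: n_def)
    also have "\<epsilon> / 24 \<le> real s / real (card U)"
    proof -
      have "\<epsilon> / 24 * real (card U) \<le> \<epsilon> / 24 * (2 * real K)"
        using K12 \<epsilon> unfolding cU by (intro mult_left_mono) auto
      also have "\<dots> \<le> real s" using s2 by simp
      finally show ?thesis using cU by (simp add: le_divide_eq)
    qed
    then have "\<epsilon> / 24 * real n \<le> real s / real (card U) * real n"
      by (intro mult_right_mono) auto
    finally show ?thesis by (simp add: mult.commute)
  qed
  finally have small: "real (card \<F>) < exp (real n * real s / real (card U))" by simp
  obtain S where S: "S \<subseteq> U" "card S \<le> s" and hit: "\<And>W. W \<in> \<F> \<Longrightarrow> W \<inter> S \<noteq> {}"
    by (rule hitting_set[OF fU fF _ _ small]) (auto simp: \<F>_def)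
  have fS: "finite S" using S(1) fU finite_subset by blast
  \<comment> \<open>The radius \<open>3 / K\<close> is the rounding error of \<open>w\<close>, so
    hitting the cell of a point puts the point itself in the interval.\<close>
  define I where "I m = {(real_of_int m - 3) / real K..(real_of_int m + 3) / real K}" for m
  define G where "G = (\<Union>m\<in>S. I m)"
  show ?thesis
  proof (intro bexI[of _ G] conjI allI impI)
    show "G \<in> sets borel" unfolding G_def I_def using fS by (intro sets.finite_UN) auto
    have "emeasure lborel G \<le> (\<Sum>m\<in>S. emeasure lborel (I m))"
      unfolding G_def using fS by (intro emeasure_subadditive_finite) (auto simp: I_def)
    also have "\<dots> = (\<Sum>m\<in>S. ennreal (6 / real K))"
    proof (intro sum.cong refl)
      fix m
      have "(real_of_int m + 3) / real K - (real_of_int m - 3) / real K = 6 / real K"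
        by (simp add: diff_divide_distrib[symmetric])
      moreover have "(real_of_int m - 3) / real K \<le> (real_of_int m + 3) / real K"
        by (simp add: divide_right_mono)
      ultimately show "emeasure lborel (I m) = ennreal (6 / real K)"
        by (simp add: I_def)
    qed
    also have "\<dots> = ennreal (real (card S) * (6 / real K))"
      by (subst ennreal_mult) (auto simp: ennreal_of_nat_eq_real_of_nat)
    also have "\<dots> \<le> ennreal \<epsilon>"
    proof (rule ennreal_leI)
      have "real (card S) * (6 / real K) \<le> (\<epsilon> * real K / 6) * (6 / real K)"
        using S(2) s1 by (intro mult_right_mono) auto
      then show "real (card S) * (6 / real K) \<le> \<epsilon>" using K12 by simp
    qed
    finally show "emeasure lborel G \<le> ennreal \<epsilon>" .
  next
    fix x t assume xt: "1 / R \<le> \<bar>t\<bar> \<and> \<bar>t\<bar> \<le> R \<and> (\<lambda>e. x + t * e) ` E \<subseteq> {0..1}"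
    then have t: "1 / R \<le> \<bar>t\<bar>" "\<bar>t\<bar> \<le> R" and sub: "(\<lambda>e. x + t * e) ` E \<subseteq> {0..1}" by auto
    define p where "p = \<lfloor>real K * x\<rfloor>"
    define q where "q = \<lfloor>real K * B * t\<rfloor>"
    \<comment> \<open>Three roundings, of \<open>K * x\<close>, of \<open>K * B * t\<close> and in
      \<open>w\<close>, contribute at most 1 each.\<close>
    have near: "\<bar>real K * (x + t * f) - real_of_int (w p q f)\<bar> \<le> 3" if "f \<in> F" for f
    proof -
      have fB: "\<bar>f / B\<bar> \<le> 1" using that F(2) B by auto
      have "\<bar>real K * B * t - real_of_int q\<bar> \<le> 1" unfolding q_def by linarith
      then have "\<bar>(real K * B * t - real_of_int q) * (f / B)\<bar> \<le> 1"
        using fB by (simp only: abs_mult) (meson abs_ge_zero mult_le_one)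
      moreover have "(real K * B * t - real_of_int q) * (f / B) = real K * t * f - real_of_int q * f / B"
        using B(1) by (simp add: field_simps)
      ultimately have "\<bar>real K * t * f - real_of_int q * f / B\<bar> \<le> 1" by metis
      moreover have "\<bar>real K * x - real_of_int p\<bar> \<le> 1" unfolding p_def by linarith
      moreover have "real K * (x + t * f) = real K * x + real K * t * f" by (simp add: algebra_simps)
      ultimately show ?thesis unfolding w_def by linarith
    qed
    have inU: "w p q f \<in> U" if f: "f \<in> F" for f
    proof -
      have "x + t * f \<in> {0..1}" using sub f F(2) by blast
      then have "0 \<le> real K * (x + t * f)" "real K * (x + t * f) \<le> real K"
        by (auto intro: mult_left_le)
      with near[OF f] show ?thesis unfolding U_def by (auto; linarith)
    qed
    have inj: "inj_on (w p q) F"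
    proof (rule inj_onI, rule ccontr)
      fix f g assume fg: "f \<in> F" "g \<in> F" "w p q f = w p q g" "f \<noteq> g"
      have "\<delta> / R \<le> \<bar>t\<bar> * \<bar>f - g\<bar>"
        using mult_mono[OF t(1) separatedD[OF \<delta>(3) fg(1,2,4)]] \<delta>(1) by simp
      then have "real K * (\<delta> / R) \<le> real K * (\<bar>t\<bar> * \<bar>f - g\<bar>)" by (intro mult_left_mono) auto
      moreover have "12 \<le> real K * (\<delta> / R)" using Kd R by (simp add: le_divide_eq)
      moreover have "real K * (\<bar>t\<bar> * \<bar>f - g\<bar>) = \<bar>real K * (x + t * f) - real K * (x + t * g)\<bar>"
      proof -
        have "real K * (x + t * f) - real K * (x + t * g) = real K * (t * (f - g))"
          by (simp add: algebra_simps)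
        then show ?thesis by (simp add: abs_mult)
      qed
      ultimately show False using near[OF fg(1)] near[OF fg(2)] fg(3) by linarith
    qed
    have W: "w p q ` F \<in> \<F>" if "F \<noteq> {}"
    proof -
      from that obtain f where f: "f \<in> F" by blast
      have "x + t * f \<in> {0..1}" using sub f F(2) by blast
      moreover have tf: "\<bar>t * f\<bar> \<le> R * B"
        unfolding abs_mult using t f F(2) B R by (intro mult_mono) auto
      ultimately have "\<bar>x\<bar> \<le> 1 + R * B" by auto
      then have "\<bar>real K * x\<bar> \<le> real K * (1 + R * B)" by (simp add: abs_mult mult_left_mono)
      then have "p \<in> {- bp..bp}" unfolding p_def bp_def by (auto; linarith)
      moreover have "\<bar>real K * B * t\<bar> \<le> real K * (R * B)"
        using t B(1) by (simp add: abs_mult mult_ac mult_right_mono)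
      then have "q \<in> {- bq..bq}" unfolding q_def bq_def by (auto; linarith)
      ultimately show ?thesis
        using inU inj by (auto simp: \<F>_def card_image n_def)
    qed
    \<comment> \<open>For empty \<open>F\<close> the bound \<open>small\<close> reads
      \<open>card \<F> < exp 0 = 1\<close>, yet \<open>\<F>\<close> would contain the empty
      pattern.\<close>
    have "F \<noteq> {}"
    proof
      assume "F = {}"
      then have "real (card \<F>) < 1" using small by (simp add: n_def)
      moreover have "{} \<in> \<F>"
        using \<open>F = {}\<close> bpq by (auto simp: \<F>_def n_def intro!: image_eqI[of _ _ "(0, 0)"])
      ultimately show False using fF by (auto simp: card_gt_0_iff)
    qed
    from hit[OF W[OF this]] obtain f where f: "f \<in> F" "w p q f \<in> S" by blast
    have "x + t * f \<in> I (w p q f)"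
      using near[OF f(1)] K12 by (auto simp: I_def field_simps)
    with f F(2) show "(\<lambda>e. x + t * e) ` E \<inter> G \<noteq> {}"
      unfolding G_def by blast
  qed
qed

text \<open>An unbounded \<open>E\<close> has no copy in the unit interval. For bounded
  \<open>E\<close>, remove from the unit interval one small set for each range of scales from
  \<open>1 / (j + 1)\<close> to \<open>j + 1\<close>.\<close>

lemma separation_rich_not_measure_universal:
  assumes "separation_rich E"
  shows "\<not> measure_universal E"
proof (cases "bounded E")
  case False
  have "bounded E" if "t \<noteq> 0" "(\<lambda>e. x + t * e) ` E \<subseteq> {0..1}" for x t :: real
  proof -
    have "bounded ((\<lambda>y. (y - x) / t) ` {0..1})"
      using that(1) by (intro compact_imp_bounded compact_continuous_image continuous_intros) auto
    moreover have "E \<subseteq> (\<lambda>y. (y - x) / t) ` {0..1}"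
    proof
      fix e assume "e \<in> E"
      then have "x + t * e \<in> {0..1}" using that(2) by blast
      then show "e \<in> (\<lambda>y. (y - x) / t) ` {0..1}"
        using that(1) by (intro image_eqI[of _ _ "x + t * e"]) auto
    qed
    ultimately show ?thesis using bounded_subset by blast
  qed
  with False show ?thesis
    unfolding measure_universal_def by (auto intro!: exI[of _ "{0..1}"])
next
  case True
  then obtain B0 where "\<And>e. e \<in> E \<Longrightarrow> \<bar>e\<bar> \<le> B0" by (auto simp: bounded_iff)
  then have B: "max B0 1 \<ge> 1" "\<And>e. e \<in> E \<Longrightarrow> \<bar>e\<bar> \<le> max B0 1" by (auto intro: max.coboundedI1)
  \<comment> \<open>The exponent \<open>j + 2\<close> makes the removed measure at most 1/2 in
    total.\<close>
  have "\<exists>G \<in> sets borel. emeasure lborel G \<le> ennreal ((1/2) ^ (j + 2)) \<and>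
     (\<forall>x t. 1 / real (Suc j) \<le> \<bar>t\<bar> \<and> \<bar>t\<bar> \<le> real (Suc j) \<and> (\<lambda>e. x + t * e) ` E \<subseteq> {0..1} \<longrightarrow>
      (\<lambda>e. x + t * e) ` E \<inter> G \<noteq> {})" for j
    by (rule small_set_meeting_copies[OF assms B]) (simp, simp, simp, rule power_le_one, auto)
  then obtain G where G: "\<And>j. G j \<in> sets borel" "\<And>j. emeasure lborel (G j) \<le> ennreal ((1/2) ^ (j + 2))"
    and meets: "\<And>j x t. 1 / real (Suc j) \<le> \<bar>t\<bar> \<Longrightarrow> \<bar>t\<bar> \<le> real (Suc j) \<Longrightarrow>
      (\<lambda>e. x + t * e) ` E \<subseteq> {0..1} \<Longrightarrow> (\<lambda>e. x + t * e) ` E \<inter> G j \<noteq> {}"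
    unfolding Bex_def by metis
  define L where "L = {0..1} - (\<Union>j. G j)"
  have UG: "(\<Union>j. G j) \<in> sets borel" using G(1) by auto
  then have L: "L \<in> sets borel" by (simp add: L_def)
  have geo: "(\<lambda>j. (1/2::real) ^ (j + 2)) sums (1/2)"
    using sums_mult2[OF geometric_sums[of "1/2::real"], of "1/4"] by (simp add: power_add)
  have "emeasure lborel (\<Union>j. G j) \<le> (\<Sum>j. emeasure lborel (G j))"
    using G(1) by (intro emeasure_subadditive_countably) auto
  also have "\<dots> \<le> (\<Sum>j. ennreal ((1/2) ^ (j + 2)))"
    using G(2) by (intro suminf_le) auto
  also have "\<dots> = ennreal (1/2)"
    using geo by (intro suminf_ennreal_eq) auto
  finally have half: "emeasure lborel (\<Union>j. G j) \<le> ennreal (1/2)" .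
  have "emeasure lborel L > 0"
  proof (rule ccontr)
    assume "\<not> emeasure lborel L > 0"
    then have L0: "emeasure lborel L = 0" by simp
    have "1 = emeasure lborel {0..1::real}" by simp
    also have "\<dots> \<le> emeasure lborel (L \<union> (\<Union>j. G j))"
      using L UG by (intro emeasure_mono) (auto simp: L_def)
    also have "\<dots> \<le> emeasure lborel L + emeasure lborel (\<Union>j. G j)"
      using L UG by (intro emeasure_subadditive) auto
    also have "\<dots> \<le> ennreal (1/2)" using half unfolding L0 by simp
    also have "\<dots> < ennreal 1" by (rule ennreal_lessI) auto
    finally show False by simp
  qed
  then have "L \<in> sets lebesgue" "emeasure lebesgue L > 0" using L by auto
  moreover have "\<not> (\<lambda>e. x + t * e) ` E \<subseteq> L" if "t \<noteq> 0" for x t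
  proof
    assume sub: "(\<lambda>e. x + t * e) ` E \<subseteq> L"
    obtain j :: nat where j: "max \<bar>t\<bar> (1 / \<bar>t\<bar>) \<le> real j" using real_arch_simple by blast
    then have "1 / \<bar>t\<bar> \<le> real (Suc j)" "\<bar>t\<bar> \<le> real (Suc j)" by auto
    moreover from this(1) have "1 / real (Suc j) \<le> \<bar>t\<bar>"
      using that by (simp add: field_simps)
    ultimately have "(\<lambda>e. x + t * e) ` E \<inter> G j \<noteq> {}"
      using sub by (intro meets) (auto simp: L_def)
    with sub show False unfolding L_def by blast
  qed
  ultimately show ?thesis unfolding measure_universal_def by blast
qed

section \<open>Slowly decaying sequences and their sumsets\<close>

text \<open>Passing to a subsequence whose consecutive ratios lie between \<open>c / 2\<close> and \<open>1 / 2\<close> keeps the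
  separation of \<open>N\<close> terms exponential in \<open>N\<close>, with a rate that does not depend on how close
  to \<open>0\<close> the terms are required to be.\<close>

lemma exponentially_separated_terms:
  fixes s :: "nat \<Rightarrow> real"
  assumes lim: "s \<longlonglongrightarrow> 0" and c: "0 < c" "c \<le> 1"
    and slow: "\<forall>n\<ge>n0. s n \<noteq> 0 \<and> c * \<bar>s n\<bar> \<le> \<bar>s (Suc n)\<bar>"
    and "\<beta> > 0"
  shows "\<exists>d>0. \<forall>N. \<exists>X. finite X \<and> card X = N \<and> X \<subseteq> s ` {n0..} \<and> (\<forall>x\<in>X. \<bar>x\<bar> < \<beta>) \<and>
    separated (d * (c / 2) ^ N) X"
proof -
  have nz: "\<And>n. n \<ge> n0 \<Longrightarrow> s n \<noteq> 0"
    and ratio: "\<And>n. n \<ge> n0 \<Longrightarrow> c * \<bar>s n\<bar> \<le> \<bar>s (Suc n)\<bar>"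
    using slow by auto
  have small: "\<exists>n\<ge>m. \<bar>s n\<bar> < b" if "b > 0" for b m
    using LIMSEQ_D[OF lim that] by (metis diff_zero nle_le real_norm_def)
  have step: "\<exists>n. (n0 \<le> n \<and> \<bar>s n\<bar> < \<beta>) \<and> \<bar>s n\<bar> \<le> \<bar>s m\<bar> / 2 \<and> c / 2 * \<bar>s m\<bar> \<le> \<bar>s n\<bar>"
    if m: "n0 \<le> m \<and> \<bar>s m\<bar> < \<beta>" for m
  proof -
    \<comment> \<open>At the first index where the modulus has halved, the preceding term still
      exceeds half of \<open>\<bar>s m\<bar>\<close>, so the ratio bound keeps the new term at least
      \<open>c / 2\<close> times the old one.\<close>
    define n where "n = (LEAST n. n \<ge> m \<and> \<bar>s n\<bar> \<le> \<bar>s m\<bar> / 2)"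
    have "\<exists>n\<ge>m. \<bar>s n\<bar> \<le> \<bar>s m\<bar> / 2"
      using small[of "\<bar>s m\<bar> / 2" m] nz[of m] m by (auto intro: less_imp_le)
    then have n: "n \<ge> m \<and> \<bar>s n\<bar> \<le> \<bar>s m\<bar> / 2" unfolding n_def by (rule LeastI_ex)
    have "n \<noteq> m" using n nz[of m] m by auto
    with n obtain k where k: "n = Suc k" "k \<ge> m" by (cases n) auto
    have "\<not> (k \<ge> m \<and> \<bar>s k\<bar> \<le> \<bar>s m\<bar> / 2)"
      using k(1) not_less_Least[of k "\<lambda>n. n \<ge> m \<and> \<bar>s n\<bar> \<le> \<bar>s m\<bar> / 2"] by (simp add: n_def)
    then have "c * (\<bar>s m\<bar> / 2) \<le> c * \<bar>s k\<bar>" using k c by (intro mult_left_mono) auto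
    also have "\<dots> \<le> \<bar>s n\<bar>" using ratio[of k] k m by simp
    finally show ?thesis using n m by (intro exI[of _ n]) auto
  qed
  have "\<exists>m. n0 \<le> m \<and> \<bar>s m\<bar> < \<beta>" using small[OF \<open>\<beta> > 0\<close>] by blast
  then obtain g where g0: "\<And>k. n0 \<le> g k \<and> \<bar>s (g k)\<bar> < \<beta>"
    and g: "\<And>k. \<bar>s (g (Suc k))\<bar> \<le> \<bar>s (g k)\<bar> / 2 \<and> c / 2 * \<bar>s (g k)\<bar> \<le> \<bar>s (g (Suc k))\<bar>"
    using dependent_nat_choice[of "\<lambda>_ m. n0 \<le> m \<and> \<bar>s m\<bar> < \<beta>"
      "\<lambda>_ m n. \<bar>s n\<bar> \<le> \<bar>s m\<bar> / 2 \<and> c / 2 * \<bar>s m\<bar> \<le> \<bar>s n\<bar>"] step by metis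
  define b where "b k = s (g k)" for k
  have bnz: "b k \<noteq> 0" for k using nz g0 by (simp add: b_def)
  have half: "\<bar>b (Suc k)\<bar> \<le> \<bar>b k\<bar> / 2" and low: "c / 2 * \<bar>b k\<bar> \<le> \<bar>b (Suc k)\<bar>" for k
    using g by (simp_all add: b_def)
  have b_lower: "\<bar>b 0\<bar> * (c / 2) ^ k \<le> \<bar>b k\<bar>" for k
  proof (induction k)
    case (Suc k)
    have "\<bar>b 0\<bar> * (c / 2) ^ Suc k = c / 2 * (\<bar>b 0\<bar> * (c / 2) ^ k)" by simp
    also have "\<dots> \<le> c / 2 * \<bar>b k\<bar>" using Suc c by (intro mult_left_mono) auto
    finally show ?case using low[of k] by linarith
  qed simp
  have decr: "decseq (\<lambda>k. \<bar>b k\<bar>)"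
  proof (rule decseq_SucI)
    show "\<bar>b (Suc k)\<bar> \<le> \<bar>b k\<bar>" for k using half[of k] by linarith
  qed
  have gap: "\<bar>b i\<bar> / 2 \<le> \<bar>b i - b j\<bar>" if "i < j" for i j
  proof -
    have "\<bar>b j\<bar> \<le> \<bar>b (Suc i)\<bar>" using that decr by (simp add: decseq_def)
    with half[of i] show ?thesis by linarith
  qed
  have inj: "inj b"
  proof (rule linorder_injI)
    show "b i \<noteq> b j" if "i < j" for i j using gap[OF that] bnz[of i] by auto
  qed
  show ?thesis
  \<comment> \<open>The factor 1/2 comes from \<open>gap\<close>. The bound \<open>\<beta>\<close>
    enters only through \<open>b 0\<close>, that is through the constant and not the rate.\<close>
  proof (intro exI[of _ "\<bar>b 0\<bar> / 2"] conjI allI)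
    show "\<bar>b 0\<bar> / 2 > 0" using bnz by simp
    fix N
    have gapN: "\<bar>b 0\<bar> / 2 * (c / 2) ^ N \<le> \<bar>b i - b j\<bar>" if "i < j" "i < N" for i j
    proof -
      have "\<bar>b 0\<bar> * (c / 2) ^ N \<le> \<bar>b 0\<bar> * (c / 2) ^ i"
        using that c by (intro mult_left_mono power_decreasing) auto
      with b_lower[of i] gap[OF that(1)] show ?thesis by simp
    qed
    have "\<bar>b 0\<bar> / 2 * (c / 2) ^ N \<le> \<bar>b i - b j\<bar>" if "i < N" "j < N" "i \<noteq> j" for i j
      using that gapN[of i j] gapN[of j i] by (cases "i < j") (auto simp: abs_minus_commute)
    then have "separated (\<bar>b 0\<bar> / 2 * (c / 2) ^ N) (b ` {..<N})"
      by (fastforce simp: separated_def)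
    then show "\<exists>X. finite X \<and> card X = N \<and> X \<subseteq> s ` {n0..} \<and> (\<forall>x\<in>X. \<bar>x\<bar> < \<beta>) \<and>
        separated (\<bar>b 0\<bar> / 2 * (c / 2) ^ N) X"
    proof (intro exI[of _ "b ` {..<N}"] conjI)
      show "card (b ` {..<N}) = N" using inj by (simp add: card_image inj_on_subset)
    qed (use g0 in \<open>auto simp: b_def\<close>)
  qed
qed

lemma finite_set_separated:
  assumes "finite F"
  obtains \<beta> where "0 < \<beta>" "separated \<beta> F"
proof -
  define D where "D = (\<lambda>(x, y). \<bar>x - y\<bar>) ` {(x, y) \<in> F \<times> F. x \<noteq> y}"
  have fin: "finite D"
    unfolding D_def using assms by (intro finite_imageI) (auto intro: finite_subset[of _ "F \<times> F"])
  show thesis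
  proof (rule that)
    \<comment> \<open>Inserting 1 keeps the minimum meaningful when \<open>F\<close> has at most one
      point.\<close>
    show "0 < Min (insert 1 D)" using fin by (auto simp: D_def)
    show "separated (Min (insert 1 D)) F"
      unfolding separated_def
    proof (intro ballI impI)
      fix x y assume "x \<in> F" "y \<in> F" "x \<noteq> y"
      then have "\<bar>x - y\<bar> \<in> D" by (force simp: D_def)
      then show "Min (insert 1 D) \<le> \<bar>x - y\<bar>" using fin by (intro Min_le) auto
    qed
  qed
qed

text \<open>The order of choices matters: \<open>M\<close> depends only on \<open>\<sigma>\<close>
  and the decay rate, then \<open>Y'\<close> fixes \<open>\<beta>\<close> and with it
  \<open>d\<close>, and \<open>N\<close> is taken last, large enough to absorb \<open>D\<close> and
  these constants.\<close>

lemma sumset_of_slow_sequence_not_measure_universal: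
  fixes s :: "nat \<Rightarrow> real" and Y :: "real set"
  assumes lim: "s \<longlonglongrightarrow> 0" and c: "0 < c" "c \<le> 1"
    and slow: "\<forall>n\<ge>n0. s n \<noteq> 0 \<and> c * \<bar>s n\<bar> \<le> \<bar>s (Suc n)\<bar>"
    and Y: "infinite Y"
  shows "\<not> measure_universal (s ` {n0..} + Y)"
proof (rule separation_rich_not_measure_universal, unfold separation_rich_def, intro allI impI)
  fix \<sigma> D :: real assume "\<sigma> > 0"
  define \<kappa> where "\<kappa> = c / 2"
  have \<kappa>: "0 < \<kappa>" "\<kappa> < 1" using c by (auto simp: \<kappa>_def)
  obtain M :: nat where "(1 - ln \<kappa>) / \<sigma> \<le> real M" using real_arch_simple by blast
  then have M: "1 - ln \<kappa> \<le> \<sigma> * real M" using \<open>\<sigma> > 0\<close> by (simp add: pos_divide_le_eq mult.commute)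
  obtain Y' where Y': "finite Y'" "card Y' = M" "Y' \<subseteq> Y"
    using infinite_arbitrarily_large[OF Y] by blast
  obtain \<beta> where \<beta>: "0 < \<beta>" "separated \<beta> Y'" using finite_set_separated[OF Y'(1)] .
  \<comment> \<open>Two terms below \<open>\<beta> / 4\<close> in modulus differ by less than
    \<open>\<beta> / 2\<close>, so sums with different summands from \<open>Y'\<close> stay at least
    \<open>\<beta> / 2\<close> apart.\<close>
  have "\<beta> / 4 > 0" using \<beta>(1) by simp
  from exponentially_separated_terms[OF lim c slow this]
  obtain d where d: "d > 0" and X: "\<And>N. \<exists>X. finite X \<and> card X = N \<and> X \<subseteq> s ` {n0..} \<and>
      (\<forall>x\<in>X. \<bar>x\<bar> < \<beta> / 4) \<and> separated (d * \<kappa> ^ N) X"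
    unfolding \<kappa>_def by blast
  define e where "e = min (min d (\<beta> / 2)) 1"
  have e: "0 < e" "e \<le> d" "e \<le> \<beta> / 2" "e \<le> 1" using d \<beta> by (auto simp: e_def)
  obtain N :: nat where N: "D - ln e \<le> real N" using real_arch_simple by blast
  obtain X where X: "finite X" "card X = N" "X \<subseteq> s ` {n0..}" "\<And>x. x \<in> X \<Longrightarrow> \<bar>x\<bar> < \<beta> / 4"
    "separated (d * \<kappa> ^ N) X" using X[of N] by blast
  define \<delta> where "\<delta> = e * \<kappa> ^ N"
  have \<kappa>N: "0 < \<kappa> ^ N" "\<kappa> ^ N \<le> 1" using \<kappa> by (auto simp: power_le_one)
  have \<delta>: "0 < \<delta>" "\<delta> \<le> 1" "\<delta> \<le> d * \<kappa> ^ N" "\<delta> \<le> \<beta> / 2"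
    using e \<kappa>N mult_mono[of e "\<beta> / 2" "\<kappa> ^ N" 1]
    by (auto simp: \<delta>_def mult_le_one intro: mult_right_mono)
  have gap: "\<delta> \<le> \<bar>(x + y) - (x' + y')\<bar>"
    if "x \<in> X" "y \<in> Y'" "x' \<in> X" "y' \<in> Y'" "(x, y) \<noteq> (x', y')" for x y x' y'
  proof (cases "y = y'")
    case True
    then have "d * \<kappa> ^ N \<le> \<bar>x - x'\<bar>" using that separatedD[OF X(5)] by blast
    then show ?thesis using True \<delta>(3) by simp
  next
    case False
    then have "\<beta> \<le> \<bar>y - y'\<bar>" using that separatedD[OF \<beta>(2)] by blast
    then show ?thesis using X(4)[of x] X(4)[of x'] that \<delta>(4) by linarith
  qed
  define F where "F = (\<lambda>(x, y). x + y) ` (X \<times> Y')"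
  have inj: "inj_on (\<lambda>(x, y). x + y) (X \<times> Y')"
  proof (rule inj_onI, clarify, rule ccontr)
    fix x y x' y' assume A: "x \<in> X" "y \<in> Y'" "x' \<in> X" "y' \<in> Y'" "x + y = x' + y'"
      "\<not> (x = x' \<and> y = y')"
    then have "\<delta> \<le> \<bar>(x + y) - (x' + y')\<bar>" by (intro gap) auto
    then show False using A(5) \<delta>(1) by simp
  qed
  have "separated \<delta> F"
    unfolding separated_def F_def using gap by fastforce
  moreover have "finite F" "F \<subseteq> s ` {n0..} + Y"
    using X(1,3) Y'(1,3) by (auto simp: F_def intro!: set_plus_intro)
  moreover have "card F = N * M"
    using inj X(2) Y'(2) by (simp add: F_def card_image card_cartesian_product)
  \<comment> \<open>Each of the \<open>N\<close> terms costs \<open>- ln \<kappa>\<close> in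
    separation, plus 1 as its share of \<open>D - ln e\<close>; its \<open>M\<close> translates pay
    for this by the choice of \<open>M\<close>.\<close>
  moreover have "D - ln \<delta> \<le> \<sigma> * real (N * M)"
  proof -
    have "ln \<delta> = ln e + real N * ln \<kappa>"
      unfolding \<delta>_def using e \<kappa> by (simp add: ln_mult ln_realpow)
    then have "D - ln \<delta> \<le> real N * (1 - ln \<kappa>)" using N by (simp add: algebra_simps)
    also have "\<dots> \<le> real N * (\<sigma> * real M)" using M by (intro mult_left_mono) auto
    finally show ?thesis by (simp add: mult_ac)
  qed
  ultimately show "\<exists>F \<delta>. finite F \<and> F \<subseteq> s ` {n0..} + Y \<and> 0 < \<delta> \<and> \<delta> \<le> 1 \<and>
      separated \<delta> F \<and> D - ln \<delta> \<le> \<sigma> * real (card F)"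
    using \<delta>(1,2) by metis
qed

section \<open>Differences, and application to the two kinds of sequences\<close>

lemma measure_universal_subset:
  "measure_universal E \<Longrightarrow> E' \<subseteq> E \<Longrightarrow> measure_universal E'"
  unfolding measure_universal_def by (meson image_mono order_trans)

lemma sum_and_difference_not_measure_universal:
  fixes s :: "nat \<Rightarrow> real" and X Y :: "real set"
  assumes "s \<longlonglongrightarrow> 0" "0 < c" "c \<le> 1"
    and "\<forall>n\<ge>n0. s n \<noteq> 0 \<and> c * \<bar>s n\<bar> \<le> \<bar>s (Suc n)\<bar>"
    and Y: "infinite Y" and X: "s ` {n0..} \<subseteq> X"
  shows "\<not> measure_universal (X + Y)" "\<not> measure_universal (difference_set X Y)"
proof -
  note * = sumset_of_slow_sequence_not_measure_universal[OF assms(1-4)]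
  have "s ` {n0..} + Y \<subseteq> X + Y" using X by (intro set_plus_mono2) auto
  then show "\<not> measure_universal (X + Y)" using *[OF Y] measure_universal_subset by blast
  have "infinite (uminus ` Y)" using Y by (simp add: finite_image_iff)
  moreover have "s ` {n0..} + uminus ` Y \<subseteq> difference_set X Y"
    using X by (force simp: difference_set_def elim!: set_plus_elim)
  ultimately show "\<not> measure_universal (difference_set X Y)"
    using * measure_universal_subset by blast
qed

lemma exp_lower_bound_of_ratio:
  fixes a :: "nat \<Rightarrow> real"
  assumes c: "0 < c" "c \<le> 1" and slow: "\<forall>n\<ge>n0. a n > 0 \<and> c * a n \<le> a (Suc n)"
  shows "\<exists>C>0. \<forall>\<^sub>F n in sequentially. a n \<ge> exp (- C * real n)"
\<comment> \<open>Iterating the ratio gives the rate \<open>- ln c\<close>; the extra 1 absorbs the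
  constant \<open>a n0\<close> for large \<open>n\<close>.\<close>
proof (intro exI[of _ "1 - ln c"] conjI)
  have pos: "\<And>n. n \<ge> n0 \<Longrightarrow> a n > 0" and ratio: "\<And>n. n \<ge> n0 \<Longrightarrow> c * a n \<le> a (Suc n)"
    using slow by auto
  show "1 - ln c > 0" using c ln_le_zero_iff[of c] by linarith
  have low: "a n0 * c ^ n \<le> a n" if "n \<ge> n0" for n
    using that
  proof (induction n rule: dec_induct)
    case base
    show ?case using c pos[of n0] by (simp add: mult_left_le power_le_one)
  next
    case (step n)
    have "a n0 * c ^ Suc n = c * (a n0 * c ^ n)" by simp
    also have "\<dots> \<le> c * a n" using step c by (intro mult_left_mono) auto
    finally show ?case using ratio[of n] step by linarith
  qed
  obtain m :: nat where m: "- ln (a n0) \<le> real m" using real_arch_simple by blast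
  show "\<forall>\<^sub>F n in sequentially. exp (- (1 - ln c) * real n) \<le> a n"
  proof (rule eventually_sequentiallyI[of "max m n0"])
    fix n assume n: "max m n0 \<le> n"
    have "exp (- (1 - ln c) * real n) \<le> exp (ln (a n0) + real n * ln c)"
      using m n by (simp add: algebra_simps)
    also have "\<dots> = a n0 * c ^ n"
      using c pos[of n0] by (simp add: exp_add exp_of_nat_mult)
    finally show "exp (- (1 - ln c) * real n) \<le> a n" using low[of n] n by simp
  qed
qed

theorem corollary6:
  fixes A :: "real set"
  assumes "infinite A"
  shows "(\<forall>a r :: real. a \<noteq> 0 \<and> 0 < \<bar>r\<bar> \<and> \<bar>r\<bar> < 1 \<longrightarrow>
            \<not> measure_universal ({a * r ^ n | n :: nat. n \<ge> 1} + A) \<and>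
            \<not> measure_universal (difference_set {a * r ^ n | n :: nat. n \<ge> 1} A)) \<and>
         (\<forall>a :: nat \<Rightarrow> real.
            antimono_on {1..} a \<and> (\<forall>n\<ge>1. a n > 0) \<and> a \<longlonglongrightarrow> 0 \<and>
            liminf (\<lambda>n. ereal (a (n + 1) / a n)) > 0 \<longrightarrow>
              (\<exists>C>0. \<forall>\<^sub>F n in sequentially. a n \<ge> exp (- C * real n)) \<and>
              \<not> measure_universal ({a n | n. n \<ge> 1} + A) \<and>
              \<not> measure_universal (difference_set {a n | n. n \<ge> 1} A) \<and>
              \<not> measure_universal ({a n | n. n \<ge> 1} + {a n | n. n \<ge> 1}) \<and>
              \<not> measure_universal (difference_set {a n | n. n \<ge> 1} {a n | n. n \<ge> 1}))"
proof (intro conjI allI impI)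
  fix a r :: real assume ar: "a \<noteq> 0 \<and> 0 < \<bar>r\<bar> \<and> \<bar>r\<bar> < 1"
  have lim: "(\<lambda>n. a * r ^ n) \<longlonglongrightarrow> 0"
    using ar by (auto intro!: tendsto_mult_right_zero LIMSEQ_power_zero)
  have sub: "(\<lambda>n. a * r ^ n) ` {1..} \<subseteq> {a * r ^ n | n :: nat. n \<ge> 1}" by auto
  \<comment> \<open>The absolute values accommodate a negative \<open>a\<close> or \<open>r\<close>;
    the ratio is exactly \<open>\<bar>r\<bar>\<close>.\<close>
  have slow: "\<forall>n\<ge>1. a * r ^ n \<noteq> 0 \<and> \<bar>r\<bar> * \<bar>a * r ^ n\<bar> \<le> \<bar>a * r ^ Suc n\<bar>"
    using ar by (simp add: abs_mult)
  have r: "0 < \<bar>r\<bar>" "\<bar>r\<bar> \<le> 1" using ar by auto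
  show "\<not> measure_universal ({a * r ^ n | n :: nat. n \<ge> 1} + A)"
    "\<not> measure_universal (difference_set {a * r ^ n | n :: nat. n \<ge> 1} A)"
    using sum_and_difference_not_measure_universal[OF lim r slow assms sub] .
next
  fix a :: "nat \<Rightarrow> real"
  assume a: "antimono_on {1..} a \<and> (\<forall>n\<ge>1. a n > 0) \<and> a \<longlonglongrightarrow> 0 \<and>
    liminf (\<lambda>n. ereal (a (n + 1) / a n)) > 0"
  then have pos: "\<And>n. n \<ge> 1 \<Longrightarrow> a n > 0" and lim: "a \<longlonglongrightarrow> 0" by auto
  from a obtain c' where c': "0 < ereal c'" "ereal c' < liminf (\<lambda>n. ereal (a (n + 1) / a n))"
    using ereal_dense2 by blast
  define c where "c = min c' 1"
  have c: "0 < c" "c \<le> 1" using c' by (auto simp: c_def)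
  have "\<forall>\<^sub>F n in sequentially. ereal c' < ereal (a (n + 1) / a n)"
    using c'(2) by (rule less_LiminfD)
  then obtain n1 where n1: "\<And>n. n \<ge> n1 \<Longrightarrow> c' < a (n + 1) / a n"
    by (auto simp: eventually_sequentially)
  \<comment> \<open>Index 0 is excluded because nothing is assumed about the sign of
    \<open>a 0\<close>.\<close>
  define n0 where "n0 = max n1 1"
  have slow: "\<forall>n\<ge>n0. a n > 0 \<and> c * a n \<le> a (Suc n)"
  proof (intro allI impI conjI)
    fix n assume n: "n0 \<le> n"
    then show "a n > 0" using pos by (simp add: n0_def)
    moreover have "c \<le> a (Suc n) / a n" using n1[of n] n by (simp add: c_def n0_def)
    ultimately show "c * a n \<le> a (Suc n)" by (simp add: pos_le_divide_eq)
  qed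
  show "\<exists>C>0. \<forall>\<^sub>F n in sequentially. a n \<ge> exp (- C * real n)"
    using exp_lower_bound_of_ratio[OF c slow] .
  have sub: "a ` {n0..} \<subseteq> {a n | n. n \<ge> 1}" by (auto simp: n0_def)
  have slow': "\<forall>n\<ge>n0. a n \<noteq> 0 \<and> c * \<bar>a n\<bar> \<le> \<bar>a (Suc n)\<bar>"
    using slow by (metis abs_of_pos le_SucI less_irrefl)
  \<comment> \<open>A finite set of positive values would have a positive minimum, against the limit
    0. This allows the sequence itself in the role of \<open>A\<close>.\<close>
  have inf: "infinite {a n | n. n \<ge> 1}"
  proof
    assume fin: "finite {a n | n. n \<ge> 1}"
    then have "Min {a n | n. n \<ge> 1} \<in> {a n | n. n \<ge> 1}" by (intro Min_in) auto
    then have "Min {a n | n. n \<ge> 1} > 0" using pos by auto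
    then have "\<forall>\<^sub>F n in sequentially. n \<ge> 1 \<and> a n < Min {a n | n. n \<ge> 1}"
      by (intro eventually_conj eventually_ge_at_top order_tendstoD(2)[OF lim])
    then obtain n where "n \<ge> 1" "a n < Min {a n | n. n \<ge> 1}"
      using eventually_happens'[OF sequentially_bot] by blast
    moreover have "Min {a n | n. n \<ge> 1} \<le> a n" using fin \<open>n \<ge> 1\<close> by (intro Min_le) auto
    ultimately show False by simp
  qed
  note * = sum_and_difference_not_measure_universal[OF lim c slow' _ sub]
  show "\<not> measure_universal ({a n | n. n \<ge> 1} + A)"
    "\<not> measure_universal (difference_set {a n | n. n \<ge> 1} A)"
    using *[OF assms] by blast+
  show "\<not> measure_universal ({a n | n. n \<ge> 1} + {a n | n. n \<ge> 1})"
    "\<not> measure_universal (difference_set {a n | n. n \<ge> 1} {a n | n. n \<ge> 1})"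
    using *[OF inf] by blast+
qed

end
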